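(* Let $F_2$ be the free group of rank $2$ and let $P_3\subset F_2$ be the subgroup generated by the cubes of all primitive elements of $F_2$. Then the quotient $F_2/P_3$ is isomorphic to the Heisenberg group $H(\mathbb{Z}/3\mathbb{Z})$.
   Context: An element of $F_2$ is primitive if it belongs to some two-element generating set of $F_2$. The subgroup $P_3$ is characteristic, hence normal, in $F_2$. For a commutative ring $R$, $H(R)$ denotes the Heisenberg group over $R$, i.e. the group of $3\times 3$ upper triangular matrices over $R$ with ones on the diagonal. *)

theory Defs
  imports
    "HOL-Algebra.Generated_Groups"
    "HOL-Library.Numeral_Type"
    "Jordan_Normal_Form.Matrix"
begin

section \<open>Free groups as groups of reduced words\<close>

text \<open>A letter \<open>(False, x)\<close> is the generator \<open>x\<close>, a letter \<open>(True, x)\<close> its formal inverse.\<close>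

type_synonym 'a letter = "bool \<times> 'a"

definition inv_letter :: "'a letter \<Rightarrow> 'a letter" where
  "inv_letter l = (\<not> fst l, snd l)"

definition reduced :: "'a letter list \<Rightarrow> bool" where
  "reduced w \<longleftrightarrow> successively (\<lambda>l m. m \<noteq> inv_letter l) w"

fun push_letter :: "'a letter \<Rightarrow> 'a letter list \<Rightarrow> 'a letter list" where
  "push_letter l [] = [l]"
| "push_letter l (m # w) = (if m = inv_letter l then w else l # m # w)"

text \<open>On reduced words, \<open>foldr push_letter u v\<close> is the free reduction of \<open>u @ v\<close>.\<close>

definition free_group :: "'a set \<Rightarrow> 'a letter list monoid" where
  "free_group S =
    \<lparr>carrier = {w. reduced w \<and> snd ` set w \<subseteq> S}, monoid.mult = foldr push_letter, one = []\<rparr>"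

definition F2 :: "nat letter list monoid" where
  "F2 = free_group {0, 1}"

definition primitive :: "('a, 'b) monoid_scheme \<Rightarrow> 'a \<Rightarrow> bool" where
  "primitive G x \<longleftrightarrow>
    (\<exists>B. B \<subseteq> carrier G \<and> card B = 2 \<and> generate G B = carrier G \<and> x \<in> B)"

definition P3 :: "nat letter list set" where
  "P3 = generate F2 {x [^]\<^bsub>F2\<^esub> (3::nat) | x. primitive F2 x}"

section \<open>The Heisenberg group\<close>

text \<open>The coefficient ring \<open>\<int>/3\<int>\<close> is the numeral type \<^typ>\<open>3\<close>, whose ring operations are
  arithmetic modulo 3.\<close>

definition heisenberg_group :: "'a::comm_ring_1 itself \<Rightarrow> 'a mat monoid" where
  "heisenberg_group _ =
    \<lparr>carrier = {A \<in> carrier_mat 3 3. upper_triangular A \<and> (\<forall>i<3. A $$ (i, i) = 1)},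
     monoid.mult = (*), one = 1\<^sub>m 3\<rparr>"

section \<open>Well-formedness\<close>

lemma inv_letter_inv_letter [simp]: "inv_letter (inv_letter l) = l"
  by (simp add: inv_letter_def)

lemma inv_letter_neq [simp]: "inv_letter l \<noteq> l" "l \<noteq> inv_letter l"
  by (cases l; simp add: inv_letter_def)+

lemma snd_inv_letter [simp]: "snd (inv_letter l) = snd l"
  by (simp add: inv_letter_def)

lemma reduced_Nil [simp]: "reduced []"
  by (simp add: reduced_def)

lemma reduced_Cons: "reduced (l # w) \<longleftrightarrow> reduced w \<and> (w = [] \<or> hd w \<noteq> inv_letter l)"
  by (cases w) (auto simp: reduced_def)

lemma reduced_push_letter: "reduced w \<Longrightarrow> reduced (push_letter l w)"
  by (cases w) (auto simp: reduced_Cons)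

lemma set_push_letter: "snd ` set (push_letter l w) \<subseteq> insert (snd l) (snd ` set w)"
  by (cases w) auto

lemma push_letter_inv: "reduced w \<Longrightarrow> push_letter (inv_letter l) (push_letter l w) = w"
proof (cases w)
  case (Cons m v)
  assume "reduced w"
  with Cons show ?thesis by (cases v) (auto simp: reduced_Cons)
qed simp

lemma push_letter_inv': "reduced w \<Longrightarrow> push_letter l (push_letter (inv_letter l) w) = w"
  using push_letter_inv[of w "inv_letter l"] by simp

lemma reduced_foldr: "reduced v \<Longrightarrow> reduced (foldr push_letter u v)"
  by (induction u) (auto intro: reduced_push_letter)

lemma set_foldr: "snd ` set (foldr push_letter u v) \<subseteq> snd ` set u \<union> snd ` set v"
proof (induction u)
  case (Cons l u)
  have "snd ` set (foldr push_letter (l # u) v) \<subseteq>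
      insert (snd l) (snd ` set (foldr push_letter u v))"
    using set_push_letter[of l "foldr push_letter u v"] by simp
  also have "\<dots> \<subseteq> insert (snd l) (snd ` set u \<union> snd ` set v)"
    by (intro insert_mono Cons.IH)
  finally show ?case by simp
qed simp

lemma foldr_push_letter_Nil: "reduced u \<Longrightarrow> foldr push_letter u [] = u"
proof (induction u)
  case (Cons l u)
  then show ?case by (cases u) (auto simp: reduced_Cons)
qed simp

lemma foldr_push_push:
  "reduced w \<Longrightarrow> foldr push_letter (push_letter l v) w = push_letter l (foldr push_letter v w)"
  by (cases v) (auto simp: push_letter_inv' reduced_foldr)

lemma foldr_push_letter_assoc:
  "reduced w \<Longrightarrow>
    foldr push_letter (foldr push_letter u v) w = foldr push_letter u (foldr push_letter v w)"
  by (induction u) (simp_all add: foldr_push_push)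

lemma foldr_push_inverse:
  "reduced w \<Longrightarrow> foldr push_letter (map inv_letter (rev u)) (foldr push_letter u w) = w"
  by (induction u arbitrary: w) (auto simp: push_letter_inv reduced_foldr)

lemma reduced_inverse: "reduced w \<Longrightarrow> reduced (map inv_letter (rev w))"
  unfolding reduced_def successively_map successively_rev
  by (erule successively_mono) (auto dest: arg_cong[of _ _ inv_letter])

lemma group_free_group: "group (free_group S)"
proof (rule groupI)
  fix u v assume "u \<in> carrier (free_group S)" "v \<in> carrier (free_group S)"
  then show "u \<otimes>\<^bsub>free_group S\<^esub> v \<in> carrier (free_group S)"
    using order_trans[OF set_foldr[of u v], of S] by (simp add: free_group_def reduced_foldr)
next
  fix u assume u: "u \<in> carrier (free_group S)"
  let ?v = "map inv_letter (rev u)"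
  have "?v \<in> carrier (free_group S)"
    using u by (auto simp: free_group_def reduced_inverse)
  moreover have "?v \<otimes>\<^bsub>free_group S\<^esub> u = \<one>\<^bsub>free_group S\<^esub>"
    using u foldr_push_inverse[of "[]" u] by (simp add: free_group_def foldr_push_letter_Nil)
  ultimately show "\<exists>v \<in> carrier (free_group S). v \<otimes>\<^bsub>free_group S\<^esub> u = \<one>\<^bsub>free_group S\<^esub>"
    by blast
qed (auto simp: free_group_def foldr_push_letter_assoc)

lemma group_F2: "group F2"
  by (simp add: F2_def group_free_group)

lemma (in group) primitive_conj:
  assumes x: "primitive G x" and g: "g \<in> carrier G"
  shows "primitive G (g \<otimes> x \<otimes> inv g)"
proof -
  let ?c = "\<lambda>y. g \<otimes> y \<otimes> inv g"
  obtain B where B: "B \<subseteq> carrier G" "card B = 2" "generate G B = carrier G" "x \<in> B"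
    using x by (auto simp: primitive_def)
  have hom: "?c \<in> hom G G"
    using g by (auto simp: hom_def m_assoc) (simp add: m_assoc[symmetric])
  then interpret c: group_hom G G ?c by unfold_locales
  have inj: "inj_on ?c (carrier G)"
    using g by (auto simp: inj_on_def)
  have "?c ` carrier G = carrier G"
  proof
    show "carrier G \<subseteq> ?c ` carrier G"
    proof
      fix y assume "y \<in> carrier G"
      moreover from this g have "?c (inv g \<otimes> y \<otimes> g) = (g \<otimes> inv g) \<otimes> y \<otimes> (g \<otimes> inv g)"
        by (simp only: m_assoc m_closed inv_closed)
      ultimately show "y \<in> ?c ` carrier G"
        using g by (intro image_eqI[of _ _ "inv g \<otimes> y \<otimes> g"]) simp_all
    qed
  qed (use g in auto)
  then have "generate G (?c ` B) = carrier G"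
    using c.generate_img[of B] B by simp
  moreover have "card (?c ` B) = 2"
    using B inj by (metis card_image inj_on_subset)
  ultimately show ?thesis
    using B g unfolding primitive_def by (intro exI[of _ "?c ` B"]) auto
qed

lemma normal_P3: "P3 \<lhd> F2"
proof -
  interpret group F2 by (rule group_F2)
  let ?A = "{x [^]\<^bsub>F2\<^esub> (3::nat) | x. primitive F2 x}"
  have sub: "?A \<subseteq> carrier F2"
    by (auto simp: primitive_def)
  have "g \<otimes>\<^bsub>F2\<^esub> y \<otimes>\<^bsub>F2\<^esub> inv\<^bsub>F2\<^esub> g \<in> ?A" if y: "y \<in> ?A" and g: "g \<in> carrier F2" for y g
  proof -
    obtain x where x: "primitive F2 x" "y = x [^]\<^bsub>F2\<^esub> (3::nat)" using y by blast
    then have xc: "x \<in> carrier F2" by (auto simp: primitive_def)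
    let ?c = "\<lambda>y. g \<otimes>\<^bsub>F2\<^esub> y \<otimes>\<^bsub>F2\<^esub> inv\<^bsub>F2\<^esub> g"
    have "?c \<in> hom F2 F2"
      using g by (auto simp: hom_def m_assoc) (simp add: m_assoc[symmetric])
    then interpret c: group_hom F2 F2 ?c by unfold_locales
    have "?c y = ?c x [^]\<^bsub>F2\<^esub> (3::nat)"
      using c.hom_nat_pow[OF xc, of 3] x by simp
    then show ?thesis using primitive_conj[OF x(1) g] by blast
  qed
  then show ?thesis
    unfolding P3_def using normal_generateI[OF sub] by blast
qed

lemma less_3E:
  assumes "i < (3::nat)" obtains "i = 0" | "i = Suc 0" | "i = 2"
  using assms by linarith

lemma all_less_3: "(\<forall>i<3. P i) \<longleftrightarrow> P (0::nat) \<and> P (Suc 0) \<and> P 2"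
  by (auto elim: less_3E)

definition heisenberg_mat :: "'a::comm_ring_1 \<Rightarrow> 'a \<Rightarrow> 'a \<Rightarrow> 'a mat" where
  "heisenberg_mat a b c = mat_of_rows_list 3 [[1, a, c], [0, 1, b], [0, 0, 1]]"

lemma heisenberg_mat_in_carrier_mat [simp]: "heisenberg_mat a b c \<in> carrier_mat 3 3"
  by (auto simp: heisenberg_mat_def mat_of_rows_list_def)

lemma heisenberg_mat_dim [simp]:
  "dim_row (heisenberg_mat a b c) = 3" "dim_col (heisenberg_mat a b c) = 3"
  by (simp_all add: heisenberg_mat_def mat_of_rows_list_def)

lemma heisenberg_mat_index [simp]:
  "heisenberg_mat a b c $$ (0, 0) = 1" "heisenberg_mat a b c $$ (0, Suc 0) = a"
  "heisenberg_mat a b c $$ (0, 2) = c" "heisenberg_mat a b c $$ (Suc 0, 0) = 0"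
  "heisenberg_mat a b c $$ (Suc 0, Suc 0) = 1" "heisenberg_mat a b c $$ (Suc 0, 2) = b"
  "heisenberg_mat a b c $$ (2, 0) = 0" "heisenberg_mat a b c $$ (2, Suc 0) = 0"
  "heisenberg_mat a b c $$ (2, 2) = 1"
  by (simp_all add: heisenberg_mat_def mat_of_rows_list_def)

lemma upper_triangular_3_iff:
  assumes "A \<in> carrier_mat 3 3"
  shows "upper_triangular A \<longleftrightarrow> A $$ (Suc 0, 0) = 0 \<and> A $$ (2, 0) = 0 \<and> A $$ (2, Suc 0) = 0"
  using assms by (auto simp: upper_triangular_def all_less_3 less_2_cases_iff)

lemma eq_mat_3I:
  assumes "A \<in> carrier_mat 3 3" "B \<in> carrier_mat 3 3"
    "\<forall>i<3. \<forall>j<3. A $$ (i, j) = B $$ (i, j)"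
  shows "A = B"
  using assms by (intro eq_matI) auto

lemma carrier_heisenberg_group:
  "carrier (heisenberg_group TYPE('a::comm_ring_1)) =
    {heisenberg_mat a b c | a b c :: 'a. True}"
proof (intro Set.set_eqI iffI)
  fix A :: "'a mat" assume A: "A \<in> carrier (heisenberg_group TYPE('a))"
  then have car: "A \<in> carrier_mat 3 3" by (simp add: heisenberg_group_def)
  with A have "A = heisenberg_mat (A $$ (0, 1)) (A $$ (1, 2)) (A $$ (0, 2))"
    by (intro eq_mat_3I) (simp_all add: heisenberg_group_def upper_triangular_3_iff all_less_3)
  then show "A \<in> {heisenberg_mat a b c | a b c :: 'a. True}" by blast
next
  fix A :: "'a mat" assume "A \<in> {heisenberg_mat a b c | a b c :: 'a. True}"
  then show "A \<in> carrier (heisenberg_group TYPE('a))"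
    by (auto simp: heisenberg_group_def upper_triangular_3_iff all_less_3)
qed

lemma mult_mat_3_index:
  assumes "A \<in> carrier_mat 3 3" "B \<in> carrier_mat 3 3" "i < 3" "j < 3"
  shows "(A * B) $$ (i, j) =
    A $$ (i, 0) * B $$ (0, j) + A $$ (i, Suc 0) * B $$ (Suc 0, j) + A $$ (i, 2) * B $$ (2, j)"
  using assms by (simp add: scalar_prod_def eval_nat_numeral)

lemma heisenberg_mat_mult:
  "heisenberg_mat a b c * heisenberg_mat a' b' c' =
    heisenberg_mat (a + a') (b + b') (c + c' + a * b')"
  by (rule eq_mat_3I)
    (auto simp: all_less_3 mult_mat_3_index algebra_simps simp del: index_mult_mat(1)
      intro!: mult_carrier_mat[of _ 3 3])

lemma one_heisenberg_mat: "1\<^sub>m 3 = heisenberg_mat 0 0 0"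
  by (rule eq_mat_3I) (auto simp: all_less_3)

lemma mult_heisenberg_group [simp]: "A \<otimes>\<^bsub>heisenberg_group TYPE('a::comm_ring_1)\<^esub> B = A * B"
  by (simp add: heisenberg_group_def)

lemma one_heisenberg_group [simp]:
  "\<one>\<^bsub>heisenberg_group TYPE('a::comm_ring_1)\<^esub> = heisenberg_mat 0 0 0"
  by (simp add: heisenberg_group_def one_heisenberg_mat)

lemma group_heisenberg_group: "group (heisenberg_group TYPE('a::comm_ring_1))"
proof (rule groupI)
  fix A assume "A \<in> carrier (heisenberg_group TYPE('a))"
  then obtain a b c where "A = heisenberg_mat a b c" by (auto simp: carrier_heisenberg_group)
  then have "heisenberg_mat (- a) (- b) (a * b - c) * A = heisenberg_mat 0 0 0"
    by (simp add: heisenberg_mat_mult)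
  then show "\<exists>B \<in> carrier (heisenberg_group TYPE('a)).
      B \<otimes>\<^bsub>heisenberg_group TYPE('a)\<^esub> A = \<one>\<^bsub>heisenberg_group TYPE('a)\<^esub>"
    by (auto simp: carrier_heisenberg_group)
qed (auto simp: carrier_heisenberg_group heisenberg_mat_mult algebra_simps, blast)

end

theory Submission
  imports Defs
begin

text \<open>
  The group \<open>H = H(\<int>/3)\<close> has exponent 3, so every homomorphism from \<open>F\<^sub>2\<close> to \<open>H\<close> kills \<open>P\<^sub>3\<close>.
  Sending the free generators \<open>a\<close> and \<open>b\<close> to the two elementary matrices next to the diagonal
  therefore induces a homomorphism from \<open>Q = F\<^sub>2 / P\<^sub>3\<close> to \<open>H\<close>, and the task is to show that \<open>Q\<close>
  is no larger than \<open>H\<close>.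

  Only four of the cubes in \<open>P\<^sub>3\<close> are used for that: those of \<open>a\<close>, \<open>b\<close>, \<open>a b\<close> and \<open>a b\<^sup>-\<^sup>1\<close>, which
  are primitive because a Nielsen move takes \<open>{a, b}\<close> to a basis containing the product
  (\<open>primitive_basis\<close>, \<open>primitive_mult\<close>). As in the classical computation of the Burnside
  group \<open>B(2, 3)\<close>, the relations \<open>(a b)\<^sup>3 = (a b\<^sup>-\<^sup>1)\<^sup>3 = b\<^sup>3 = 1\<close> make \<open>a\<close> commute with its
  conjugate \<open>b a b\<^sup>-\<^sup>1\<close> (\<open>commutes_conj_if_cubes\<close>). Together with the mirror image of this fact,
  it makes the commutator \<open>[b, a]\<close> central (\<open>comm_commutes_a\<close>, \<open>comm_commutes_b\<close>) and of cube 1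
  (\<open>cube_comm\<close>). Hence every element of \<open>Q\<close> can be written \<open>a\<^sup>i b\<^sup>j [b, a]\<^sup>k\<close>
  (\<open>generate_subset_normal_forms\<close>), where only the residues of \<open>i\<close>, \<open>j\<close>, \<open>k\<close> modulo 3 matter. The
  image of this element in \<open>H\<close> has the entries \<open>i\<close>, \<open>j\<close> and \<open>i j - k\<close>, from which these residues
  can be read off, and every matrix in \<open>H\<close> arises in this way. So the induced homomorphism is
  bijective (\<open>iso_heisenberg_group\<close>).
\<close>

section \<open>Evaluating words in a group\<close>

text \<open>
  The homomorphism out of a free group given by its universal property, with \<open>g\<close> the values on the
  generators. It is defined on all words, reduced or not, which allows induction on the word.
\<close>

definition word_value :: "('g, 'm) monoid_scheme \<Rightarrow> ('a \<Rightarrow> 'g) \<Rightarrow> 'a letter list \<Rightarrow> 'g" where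
  "word_value G g w =
    foldr (\<lambda>l x. (if fst l then inv\<^bsub>G\<^esub> g (snd l) else g (snd l)) \<otimes>\<^bsub>G\<^esub> x) w \<one>\<^bsub>G\<^esub>"

lemma word_value_Nil [simp]: "word_value G g [] = \<one>\<^bsub>G\<^esub>"
  by (simp add: word_value_def)

lemma word_value_Cons:
  "word_value G g (l # w) = (if fst l then inv\<^bsub>G\<^esub> g (snd l) else g (snd l)) \<otimes>\<^bsub>G\<^esub> word_value G g w"
  by (simp add: word_value_def)

context group
begin

lemma inv_mult_cancel [simp]:
  "x \<in> carrier G \<Longrightarrow> y \<in> carrier G \<Longrightarrow> inv x \<otimes> (x \<otimes> y) = y"
  "x \<in> carrier G \<Longrightarrow> y \<in> carrier G \<Longrightarrow> x \<otimes> (inv x \<otimes> y) = y"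
  by (simp_all add: m_assoc[symmetric])

lemma pow_Suc_mult:
  assumes "x \<in> carrier G" "y \<in> carrier G"
  shows "x \<otimes> (x [^] (n::nat) \<otimes> y) = x [^] Suc n \<otimes> y"
  using assms by (metis m_assoc nat_pow_Suc2 nat_pow_closed)

lemma word_value_closed:
  assumes "g ` S \<subseteq> carrier G" "snd ` set w \<subseteq> S"
  shows "word_value G g w \<in> carrier G"
  using assms(2)
proof (induction w)
  case (Cons l w)
  then show ?case using assms(1) by (auto simp: word_value_Cons)
qed simp

text \<open>Free reduction does not change the value of a word: a cancelled pair of letters has value 1.\<close>

lemma word_value_push_letter:
  assumes g: "g ` S \<subseteq> carrier G" and w: "snd ` set (l # w) \<subseteq> S"
  shows "word_value G g (push_letter l w) = word_value G g (l # w)"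
proof (cases "w \<noteq> [] \<and> hd w = inv_letter l")
  case True
  then obtain v where v: "w = inv_letter l # v" by (cases w) auto
  then have "word_value G g v \<in> carrier G" "g (snd l) \<in> carrier G"
    using g w word_value_closed[OF g, of v] by auto
  then show ?thesis
    unfolding v by (simp add: word_value_Cons inv_letter_def)
next
  case False
  then have "push_letter l w = l # w" by (cases w) auto
  then show ?thesis by simp
qed

lemma word_value_foldr_push_letter:
  assumes g: "g ` S \<subseteq> carrier G" and "snd ` set u \<subseteq> S" "snd ` set v \<subseteq> S"
  shows "word_value G g (foldr push_letter u v) = word_value G g u \<otimes> word_value G g v"
  using assms(2)
proof (induction u)
  case Nil
  then show ?case using word_value_closed[OF g assms(3)] by simp
next
  case (Cons l u)
  let ?uv = "foldr push_letter u v"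
  have uv: "snd ` set (l # ?uv) \<subseteq> S"
    using subset_trans[OF set_foldr[of u v], of S] Cons.prems assms(3) by simp
  have closed: "word_value G g u \<in> carrier G" "word_value G g v \<in> carrier G"
    "g (snd l) \<in> carrier G"
    using Cons.prems assms word_value_closed[OF g] by auto
  have "word_value G g (foldr push_letter (l # u) v) = word_value G g (l # ?uv)"
    using word_value_push_letter[OF g uv] by simp
  also have "\<dots> = word_value G g (l # u) \<otimes> word_value G g v"
    using Cons closed by (simp add: word_value_Cons m_assoc)
  finally show ?case .
qed

lemma word_value_hom:
  assumes "g ` S \<subseteq> carrier G"
  shows "word_value G g \<in> hom (free_group S) G"
  using word_value_closed[OF assms] word_value_foldr_push_letter[OF assms]
  by (auto simp: hom_def free_group_def)

end

lemma letter_mem_free_group: "x \<in> S \<Longrightarrow> [(s, x)] \<in> carrier (free_group S)"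
  by (simp add: free_group_def reduced_Cons)

lemma inv_letter_free_group:
  assumes "x \<in> S"
  shows "inv\<^bsub>free_group S\<^esub> [(False, x)] = [(True, x)]"
proof -
  interpret group "free_group S" by (rule group_free_group)
  have "[(True, x)] \<otimes>\<^bsub>free_group S\<^esub> [(False, x)] = \<one>\<^bsub>free_group S\<^esub>"
    by (simp add: free_group_def inv_letter_def)
  then show ?thesis
    using assms by (intro inv_equality letter_mem_free_group)
qed

text \<open>
  Prepending a letter to a reduced word is multiplication by a one-letter word as long as the result
  is still reduced, so the generators are reached by peeling off one letter at a time.
\<close>

lemma generate_letters_free_group:
  "generate (free_group S) ((\<lambda>x. [(False, x)]) ` S) = carrier (free_group S)"
proof
  interpret group "free_group S" by (rule group_free_group)
  let ?L = "(\<lambda>x. [(False, x)]) ` S"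
  show "generate (free_group S) ?L \<subseteq> carrier (free_group S)"
    by (rule generate_incl) (auto intro: letter_mem_free_group)
  have "w \<in> generate (free_group S) ?L" if "reduced w" "snd ` set w \<subseteq> S" for w
    using that
  proof (induction w)
    case Nil
    then show ?case using generate.one[of "free_group S" ?L] by (simp add: free_group_def)
  next
    case (Cons l w)
    have l: "snd l \<in> S" using Cons.prems by simp
    have "l = (fst l, snd l)" by simp
    then have "[l] \<in> generate (free_group S) ?L"
      using generate.incl[of "[(False, snd l)]" ?L "free_group S"]
        generate.inv[of "[(False, snd l)]" ?L "free_group S"] l
      by (cases "fst l") (auto simp: inv_letter_free_group)
    moreover have "w \<in> generate (free_group S) ?L"
      using Cons by (simp add: reduced_Cons)
    moreover have "l # w = [l] \<otimes>\<^bsub>free_group S\<^esub> w"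
      using Cons.prems by (cases w) (auto simp: free_group_def reduced_Cons)
    ultimately show ?case by (metis generate.eng)
  qed
  then show "carrier (free_group S) \<subseteq> generate (free_group S) ?L"
    by (auto simp: free_group_def)
qed

section \<open>Primitive elements\<close>

context group
begin

text \<open>
  If \<open>b\<close> is recovered from \<open>a\<close> and \<open>x\<close>, then \<open>{a, x}\<close> generates as well. The condition \<open>x \<noteq> a\<close>
  keeps this set at two elements.
\<close>

lemma primitive_exchange:
  assumes gen: "generate G {a, b} = carrier G"
    and x: "x \<in> carrier G" "x \<noteq> a" and b: "b \<in> generate G {a, x}"
  shows "primitive G x"
proof -
  have a: "a \<in> carrier G" using generate.incl[of a "{a, b}" G] gen by simp
  have "{a, b} \<subseteq> generate G {a, x}"
    using b by (auto intro: generate.incl)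
  moreover have "subgroup (generate G {a, x}) G"
    using a x by (intro generate_is_subgroup) auto
  ultimately have "generate G {a, b} \<subseteq> generate G {a, x}"
    by (rule generate_subgroup_incl)
  then have "generate G {a, x} = carrier G"
    using gen a x generate_incl[of "{a, x}"] by auto
  then show ?thesis
    using a x unfolding primitive_def by (intro exI[of _ "{a, x}"]) auto
qed

lemma primitive_basis:
  assumes gen: "generate G {a, b} = carrier G" and ne: "a \<noteq> b"
  shows "primitive G a" "primitive G b"
  using assms generate.incl[of _ "{a, b}" G]
  unfolding primitive_def by (auto intro!: exI[of _ "{a, b}"])

lemma primitive_mult:
  assumes gen: "generate G {a, b} = carrier G" and ne: "b \<noteq> \<one>"
  shows "primitive G (a \<otimes> b)" "primitive G (a \<otimes> inv b)"
proof -
  have ab: "a \<in> carrier G" "b \<in> carrier G"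
    using generate.incl[of _ "{a, b}" G] gen by auto
  \<comment> \<open>The two ways of recovering \<open>b\<close> from \<open>a\<close> and the new element.\<close>
  have b: "b = inv a \<otimes> (a \<otimes> b)" "b = inv (a \<otimes> inv b) \<otimes> a"
    using ab by (simp_all add: inv_mult_group m_assoc)
  have "inv a \<otimes> (a \<otimes> b) \<in> generate G {a, a \<otimes> b}"
    by (intro generate.eng generate.inv generate.incl) auto
  then show "primitive G (a \<otimes> b)"
    using b(1) ab ne by (intro primitive_exchange[OF gen]) auto
  have "inv (a \<otimes> inv b) \<otimes> a \<in> generate G {a, a \<otimes> inv b}"
    by (intro generate.eng generate.inv generate.incl) auto
  then show "primitive G (a \<otimes> inv b)"
    using b(2) ab ne by (intro primitive_exchange[OF gen]) auto
qed

end

section \<open>Two generators and four cubes\<close>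

context group
begin

lemma cube_eq: "x \<in> carrier G \<Longrightarrow> x [^] (3::nat) = x \<otimes> (x \<otimes> x)"
  by (simp add: numeral_3_eq_3 m_assoc)

lemma commutes_inv:
  assumes "x \<in> carrier G" "y \<in> carrier G" "x \<otimes> y = y \<otimes> x"
  shows "inv x \<otimes> y = y \<otimes> inv x"
proof -
  have "inv x \<otimes> y = inv x \<otimes> (y \<otimes> x) \<otimes> inv x"
    using assms(1,2) by (simp add: m_assoc)
  also have "\<dots> = y \<otimes> inv x"
    using assms(1,2) by (simp add: assms(3)[symmetric])
  finally show ?thesis .
qed

lemma cube_mult_commute:
  assumes "x \<in> carrier G" "y \<in> carrier G" and cube: "(x \<otimes> y) [^] (3::nat) = \<one>"
  shows "(y \<otimes> x) [^] (3::nat) = \<one>"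
proof -
  have "(y \<otimes> x) [^] (3::nat) = y \<otimes> (x \<otimes> y) [^] (3::nat) \<otimes> inv y"
    using assms(1,2) by (simp add: cube_eq m_assoc)
  then show ?thesis using assms by simp
qed

text \<open>
  A relation \<open>(u v)\<^sup>3 = 1\<close> says that \<open>u v u = v\<^sup>-\<^sup>1 u\<^sup>-\<^sup>1 v\<^sup>-\<^sup>1\<close>. Applied to \<open>x y\<close> and to \<open>x y\<^sup>-\<^sup>1\<close>, it
  brings both products of \<open>x\<close> and \<open>y x y\<^sup>-\<^sup>1\<close> to the form \<open>y\<^sup>-\<^sup>1 x\<^sup>-\<^sup>1 y\<close>, since \<open>y\<^sup>2 = y\<^sup>-\<^sup>1\<close>.
\<close>

lemma commutes_conj_if_cubes:
  assumes x: "x \<in> carrier G" and y: "y \<in> carrier G"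
    and cube_y: "y [^] (3::nat) = \<one>"
    and cube_xy: "(x \<otimes> y) [^] (3::nat) = \<one>"
    and cube_xy': "(x \<otimes> inv y) [^] (3::nat) = \<one>"
  shows "x \<otimes> (y \<otimes> x \<otimes> inv y) = (y \<otimes> x \<otimes> inv y) \<otimes> x"
proof -
  have aba: "u \<otimes> (v \<otimes> u) = inv v \<otimes> (inv u \<otimes> inv v)"
    if "u \<in> carrier G" "v \<in> carrier G" "(u \<otimes> v) [^] (3::nat) = \<one>" for u v
  proof -
    have "(u \<otimes> (v \<otimes> u)) \<otimes> (v \<otimes> (u \<otimes> v)) = \<one>"
      using that by (simp add: cube_eq m_assoc)
    then have "inv (v \<otimes> (u \<otimes> v)) = u \<otimes> (v \<otimes> u)"
      using that by (intro inv_equality) auto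
    then show ?thesis using that by (simp add: inv_mult_group m_assoc)
  qed
  have yy: "y \<otimes> y = inv y"
    using y cube_y by (intro inv_equality[symmetric]) (simp_all add: cube_eq m_assoc)
  then have yy': "inv y \<otimes> inv y = y"
    using y by (metis inv_inv inv_mult_group)
  have "x \<otimes> (y \<otimes> x \<otimes> inv y) = x \<otimes> (y \<otimes> x) \<otimes> inv y"
    using x y by (simp add: m_assoc)
  also have "\<dots> = inv y \<otimes> (inv x \<otimes> (inv y \<otimes> inv y))"
    using x y by (simp add: aba[OF x y cube_xy] m_assoc)
  also have "\<dots> = (y \<otimes> y) \<otimes> (inv x \<otimes> y)"
    by (simp add: yy yy')
  also have "\<dots> = y \<otimes> (x \<otimes> (inv y \<otimes> x))"
    using x y aba[OF x inv_closed[OF y] cube_xy'] by (simp add: m_assoc)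
  also have "\<dots> = (y \<otimes> x \<otimes> inv y) \<otimes> x"
    using x y by (simp add: m_assoc)
  finally show ?thesis .
qed

end

text \<open>
  On two generators, these four relations present the Burnside group \<open>B(2, 3)\<close>, which is the
  Heisenberg group modulo 3.
\<close>

locale four_cubes = group +
  fixes a b
  assumes gens [simp]: "a \<in> carrier G" "b \<in> carrier G"
    and cube_a: "a [^] (3::nat) = \<one>"
    and cube_b: "b [^] (3::nat) = \<one>"
    and cube_ab: "(a \<otimes> b) [^] (3::nat) = \<one>"
    and cube_ab': "(a \<otimes> inv b) [^] (3::nat) = \<one>"
begin

definition comm where "comm = b \<otimes> a \<otimes> inv b \<otimes> inv a"

lemma comm_closed [simp]: "comm \<in> carrier G"
  by (simp add: comm_def)

lemma ba_eq: "b \<otimes> a = comm \<otimes> (a \<otimes> b)"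
  by (simp add: comm_def m_assoc)

text \<open>The commutator is the product of \<open>b a b\<^sup>-\<^sup>1\<close> and \<open>a\<^sup>-\<^sup>1\<close>, and \<open>a\<close> commutes with both.\<close>

lemma comm_commutes_a: "comm \<otimes> a = a \<otimes> comm"
proof -
  have "a \<otimes> (b \<otimes> a \<otimes> inv b) = (b \<otimes> a \<otimes> inv b) \<otimes> a"
    using cube_b cube_ab cube_ab' by (intro commutes_conj_if_cubes) auto
  then have "a \<otimes> comm = (b \<otimes> a \<otimes> inv b) \<otimes> a \<otimes> inv a"
    by (simp add: comm_def m_assoc[symmetric])
  also have "\<dots> = comm \<otimes> a"
    by (simp add: comm_def m_assoc)
  finally show ?thesis by simp
qed

text \<open>
  The relations are symmetric in \<open>a\<close> and \<open>b\<close> up to conjugation and inversion, so \<open>b\<close> commutes with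
  \<open>a b a\<^sup>-\<^sup>1\<close>; the commutator is also the product of \<open>b\<close> and the inverse of this conjugate.
\<close>

lemma comm_commutes_b: "comm \<otimes> b = b \<otimes> comm"
proof -
  let ?v = "a \<otimes> b \<otimes> inv a"
  have "inv (a \<otimes> inv b) [^] (3::nat) = \<one>"
    using cube_ab' by (simp add: nat_pow_inv)
  then have "(b \<otimes> inv a) [^] (3::nat) = \<one>"
    by (simp add: inv_mult_group)
  moreover have "(b \<otimes> a) [^] (3::nat) = \<one>"
    using cube_ab by (rule cube_mult_commute[rotated 2]) auto
  ultimately have "b \<otimes> ?v = ?v \<otimes> b"
    using cube_a by (intro commutes_conj_if_cubes) auto
  then have v: "inv ?v \<otimes> b = b \<otimes> inv ?v"
    by (intro commutes_inv) auto
  have comm_eq: "comm = b \<otimes> inv ?v"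
    by (simp add: comm_def inv_mult_group m_assoc)
  have "comm \<otimes> b = b \<otimes> (inv ?v \<otimes> b)"
    unfolding comm_eq by (rule m_assoc) auto
  then show ?thesis
    unfolding v comm_eq[symmetric] .
qed

text \<open>
  The conjugate \<open>b a b\<^sup>-\<^sup>1\<close> is \<open>[b, a] a\<close>, a product of commuting elements. Its cube is 1, and so
  is the cube of \<open>a\<close>.
\<close>

lemma cube_comm: "comm [^] (3::nat) = \<one>"
proof -
  have "b \<otimes> a \<otimes> inv b = comm \<otimes> a" by (simp add: comm_def m_assoc)
  then have "(comm \<otimes> a) [^] (3::nat) = (b \<otimes> a \<otimes> inv b) [^] (3::nat)" by simp
  also have "\<dots> = b \<otimes> a [^] (3::nat) \<otimes> inv b"
    by (simp add: cube_eq m_assoc)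
  finally have "(comm \<otimes> a) [^] (3::nat) = \<one>" by (simp add: cube_a)
  then show ?thesis
    using pow_mult_distrib[OF comm_commutes_a, of 3] by (simp add: cube_a)
qed

text \<open>Moving \<open>b\<close> past a power of \<open>a\<close> costs one central commutator for each factor \<open>a\<close>.\<close>

lemma ba_pow: "b \<otimes> a [^] (i::nat) = a [^] i \<otimes> (b \<otimes> comm [^] i)"
proof (induction i)
  case (Suc i)
  have da: "comm [^] i \<otimes> a = a \<otimes> comm [^] i"
    by (intro group_commutes_pow comm_commutes_a) auto
  have "b \<otimes> a [^] Suc i = a [^] i \<otimes> (b \<otimes> (comm [^] i \<otimes> a))"
    using Suc by (simp add: m_assoc[symmetric])
  also have "\<dots> = a [^] i \<otimes> ((b \<otimes> a) \<otimes> comm [^] i)"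
    unfolding da by (simp add: m_assoc)
  also have "b \<otimes> a = a \<otimes> (b \<otimes> comm)"
  proof -
    have "b \<otimes> a = comm \<otimes> a \<otimes> b" by (simp add: ba_eq m_assoc)
    also have "\<dots> = a \<otimes> (comm \<otimes> b)" by (simp add: comm_commutes_a m_assoc)
    finally show ?thesis by (simp add: comm_commutes_b)
  qed
  finally have "b \<otimes> a [^] Suc i = a [^] i \<otimes> (a \<otimes> (b \<otimes> comm) \<otimes> comm [^] i)" .
  moreover have "comm \<otimes> comm [^] i = comm [^] i \<otimes> comm"
    using nat_pow_Suc2[OF comm_closed, of i] by simp
  ultimately show ?case
    by (simp add: m_assoc)
qed simp

definition normal_forms where
  "normal_forms = {a [^] i \<otimes> (b [^] j \<otimes> comm [^] k) | (i::nat) (j::nat) (k::nat). True}"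

lemma a_mult_normal_forms:
  assumes "x \<in> normal_forms" shows "a \<otimes> x \<in> normal_forms"
proof -
  obtain i j k :: nat where "x = a [^] i \<otimes> (b [^] j \<otimes> comm [^] k)"
    using assms by (auto simp: normal_forms_def)
  then have "a \<otimes> x = a [^] Suc i \<otimes> (b [^] j \<otimes> comm [^] k)"
    by (simp add: pow_Suc_mult del: nat_pow_Suc)
  then show ?thesis unfolding normal_forms_def by blast
qed

lemma b_mult_normal_forms:
  assumes "x \<in> normal_forms" shows "b \<otimes> x \<in> normal_forms"
proof -
  obtain i j k :: nat where x: "x = a [^] i \<otimes> (b [^] j \<otimes> comm [^] k)"
    using assms by (auto simp: normal_forms_def)
  have "comm [^] i \<otimes> b = b \<otimes> comm [^] i"
    by (intro group_commutes_pow comm_commutes_b) auto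
  then have "b [^] j \<otimes> comm [^] i = comm [^] i \<otimes> b [^] j"
    by (intro group_commutes_pow) auto
  then have db: "comm [^] i \<otimes> b [^] j = b [^] j \<otimes> comm [^] i" by simp
  have "b \<otimes> x = (b \<otimes> a [^] i) \<otimes> (b [^] j \<otimes> comm [^] k)"
    by (simp add: x m_assoc)
  also have "\<dots> = a [^] i \<otimes> (b \<otimes> ((comm [^] i \<otimes> b [^] j) \<otimes> comm [^] k))"
    by (simp add: ba_pow m_assoc)
  also have "\<dots> = a [^] i \<otimes> (b [^] Suc j \<otimes> comm [^] (i + k))"
    unfolding db by (simp add: m_assoc pow_Suc_mult nat_pow_mult del: nat_pow_Suc)
  finally show ?thesis unfolding normal_forms_def by blast
qed

text \<open>
  The normal forms contain 1 and are stable under left multiplication by \<open>a\<close> and \<open>b\<close>, hence also by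
  their inverses \<open>a\<^sup>2\<close> and \<open>b\<^sup>2\<close>.
\<close>

lemma generate_subset_normal_forms: "generate G {a, b} \<subseteq> normal_forms"
proof
  have inv: "inv x = x \<otimes> x" if "x \<in> carrier G" "x [^] (3::nat) = \<one>" for x
    using that by (intro inv_equality) (simp_all add: cube_eq m_assoc)
  have carrier: "normal_forms \<subseteq> carrier G"
    by (auto simp: normal_forms_def)
  have mult: "x \<otimes> y \<in> normal_forms" if "x \<in> generate G {a, b}" "y \<in> normal_forms" for x y
    using that
  proof (induction arbitrary: y)
    case one
    then show ?case using carrier by auto
  next
    case (incl h)
    then show ?case by (auto intro: a_mult_normal_forms b_mult_normal_forms)
  next
    case (inv h)
    have "y \<in> carrier G" using inv carrier by blast
    moreover have "inv a = a \<otimes> a" "inv b = b \<otimes> b"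
      using cube_a cube_b by (auto intro: \<open>\<And>x. _ \<Longrightarrow> _ \<Longrightarrow> inv x = x \<otimes> x\<close>)
    ultimately show ?case
      using inv a_mult_normal_forms[OF a_mult_normal_forms]
        b_mult_normal_forms[OF b_mult_normal_forms]
      by (auto simp: m_assoc)
  next
    case (eng h1 h2)
    have "h1 \<in> carrier G" "h2 \<in> carrier G" "y \<in> carrier G"
      using eng carrier generate_incl[of "{a, b}"] by auto
    then show ?case using eng by (simp add: m_assoc)
  qed
  fix x assume x: "x \<in> generate G {a, b}"
  have "\<one> = a [^] (0::nat) \<otimes> (b [^] (0::nat) \<otimes> comm [^] (0::nat))" by simp
  then have "\<one> \<in> normal_forms" unfolding normal_forms_def by blast
  from mult[OF x this] show "x \<in> normal_forms"
    using x generate_incl[of "{a, b}"] by auto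
qed

end

section \<open>The Heisenberg group modulo 3\<close>

lemma heisenberg_mat_mem [simp]:
  "heisenberg_mat x y z \<in> carrier (heisenberg_group TYPE('a::comm_ring_1))"
  by (auto simp: carrier_heisenberg_group)

lemma heisenberg_mat_eq_iff [simp]:
  "heisenberg_mat x y z = heisenberg_mat x' y' z' \<longleftrightarrow> x = x' \<and> y = y' \<and> z = z'"
  by (metis heisenberg_mat_index(2,3,6))

lemma inv_heisenberg_mat:
  "inv\<^bsub>heisenberg_group TYPE('a::comm_ring_1)\<^esub> (heisenberg_mat x y z :: 'a mat) =
    heisenberg_mat (- x) (- y) (x * y - z)"
  by (rule group.inv_equality[OF group_heisenberg_group])
    (simp_all add: heisenberg_mat_mult)

text \<open>
  Without the condition \<open>x y = 0\<close>, the corner entry of the \<open>n\<close>-th power gains a multiple of \<open>x y\<close>.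
  The generators and their commutator satisfy it.
\<close>

lemma heisenberg_mat_pow:
  assumes "x * y = 0"
  shows "heisenberg_mat x y z [^]\<^bsub>heisenberg_group TYPE('a::comm_ring_1)\<^esub> n =
    heisenberg_mat (of_nat n * x) (of_nat n * y) (of_nat n * z)"
proof -
  interpret group "heisenberg_group TYPE('a)" by (rule group_heisenberg_group)
  have zero: "x * (y * t) = 0" for t
    using assms by (simp add: mult.assoc[symmetric])
  show ?thesis
    by (induction n) (simp_all add: heisenberg_mat_mult algebra_simps zero)
qed

text \<open>
  The cube of the matrix with entries \<open>x\<close>, \<open>y\<close>, \<open>z\<close> has entries \<open>3 x\<close>, \<open>3 y\<close> and \<open>3 z + 3 x y\<close>.
\<close>

lemma heisenberg_group_cube:
  assumes "(3 :: 'a::comm_ring_1) = 0" and A: "A \<in> carrier (heisenberg_group TYPE('a))"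
  shows "A [^]\<^bsub>heisenberg_group TYPE('a)\<^esub> (3::nat) = \<one>\<^bsub>heisenberg_group TYPE('a)\<^esub>"
proof -
  interpret group "heisenberg_group TYPE('a)" by (rule group_heisenberg_group)
  obtain x y z where A_eq: "A = heisenberg_mat x y z"
    using A by (auto simp: carrier_heisenberg_group)
  have three: "3 * t = 0" for t :: 'a
    using assms(1) by simp
  have "A [^]\<^bsub>heisenberg_group TYPE('a)\<^esub> (3::nat) =
      heisenberg_mat (3 * x) (3 * y) (3 * (z + x * y))"
    using A by (simp add: cube_eq A_eq heisenberg_mat_mult algebra_simps)
  then show ?thesis
    by (simp only: three one_heisenberg_group)
qed

lemma of_nat_eq_0_iff_mod_3: "of_nat n = (0::3) \<longleftrightarrow> 3 dvd n"
  by (simp add: of_nat_eq_0_iff_char_dvd)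

lemma mod_3_of_nat: "\<exists>n. (x::3) = of_nat n"
proof (cases x)
  case (of_int z)
  then have "x = of_nat (nat z)" by simp
  then show ?thesis by blast
qed

text \<open>
  The matrix of a normal form shows its three exponents modulo 3. This makes a homomorphism with these
  values on \<open>a\<close> and \<open>b\<close> injective and surjective at once.
\<close>

lemma (in four_cubes) iso_heisenberg_group:
  assumes gen: "generate G {a, b} = carrier G"
    and hom: "f \<in> hom G (heisenberg_group TYPE(3))"
    and fa: "f a = heisenberg_mat 1 0 0" and fb: "f b = heisenberg_mat 0 1 0"
  shows "f \<in> iso G (heisenberg_group TYPE(3))"
proof -
  let ?H = "heisenberg_group TYPE(3)"
  interpret H: group ?H by (rule group_heisenberg_group)
  interpret f: group_hom G ?H f
    using hom by unfold_locales
  have fd: "f comm = heisenberg_mat 0 0 (- 1)"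
    by (simp add: comm_def fa fb inv_heisenberg_mat heisenberg_mat_mult)
  have normal_form: "f (a [^] i \<otimes> (b [^] j \<otimes> comm [^] k)) =
      heisenberg_mat (of_nat i) (of_nat j) (of_nat i * of_nat j - of_nat k)" for i j k :: nat
    by (simp add: f.hom_nat_pow fa fb fd heisenberg_mat_pow heisenberg_mat_mult)
  have "x = \<one>" if x: "x \<in> carrier G" "f x = \<one>\<^bsub>?H\<^esub>" for x
  proof -
    obtain i j k :: nat where ijk: "x = a [^] i \<otimes> (b [^] j \<otimes> comm [^] k)"
      using x gen generate_subset_normal_forms by (auto simp: normal_forms_def)
    have "of_nat i = (0::3)" "of_nat j = (0::3)" "of_nat k = (0::3)"
      using x(2) by (auto simp: ijk normal_form)
    \<comment> \<open>All exponents are multiples of 3, and \<open>a\<close>, \<open>b\<close> and the commutator have cube 1.\<close>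
    then obtain i' j' k' where "i = 3 * i'" "j = 3 * j'" "k = 3 * k'"
      unfolding of_nat_eq_0_iff_mod_3 by (auto elim!: dvdE)
    then show ?thesis
      by (simp add: ijk nat_pow_pow[symmetric] cube_a cube_b cube_comm)
  qed
  then have "inj_on f (carrier G)"
    by (subst f.inj_on_one_iff) auto
  moreover have "carrier ?H \<subseteq> f ` carrier G"
  proof
    fix A assume "A \<in> carrier ?H"
    then obtain x y z where A: "A = heisenberg_mat x y z"
      by (auto simp: carrier_heisenberg_group)
    \<comment> \<open>The corner entry \<open>z = i j - k\<close> determines the exponent \<open>k\<close>.\<close>
    obtain i j k where ijk: "x = of_nat i" "y = of_nat j" "x * y - z = of_nat k"
      using mod_3_of_nat[of x] mod_3_of_nat[of y] mod_3_of_nat[of "x * y - z"] by blast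
    have "f (a [^] i \<otimes> (b [^] j \<otimes> comm [^] k)) = heisenberg_mat x y (x * y - (x * y - z))"
      unfolding normal_form by (simp only: ijk[symmetric])
    also have "\<dots> = A"
      unfolding A by (simp only: diff_diff_eq2 add_diff_cancel_left')
    finally have "A = f (a [^] i \<otimes> (b [^] j \<otimes> comm [^] k))" by (rule sym)
    then show "A \<in> f ` carrier G"
      by (rule image_eqI) simp
  qed
  ultimately show ?thesis
    using hom by (auto simp: iso_def bij_betw_def)
qed

section \<open>The quotient by cubes of primitive elements\<close>

theorem proposition2p11:
  shows "F2 Mod P3 \<cong> heisenberg_group TYPE(3)"
proof -
  let ?H = "heisenberg_group TYPE(3)" and ?Q = "F2 Mod P3"
  let ?a = "[(False, 0)] :: nat letter list" and ?b = "[(False, 1)] :: nat letter list"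
  let ?g = "\<lambda>i::nat. if i = 0 then heisenberg_mat 1 0 0 else heisenberg_mat 0 1 0 :: 3 mat"
  interpret F2: group F2 by (rule group_F2)
  interpret H: group ?H by (rule group_heisenberg_group)
  interpret P3: normal P3 F2 by (rule normal_P3)
  interpret Q: group ?Q by (rule P3.factorgroup_is_group)
  interpret \<pi>: group_hom F2 ?Q "\<lambda>x. P3 #>\<^bsub>F2\<^esub> x"
    using P3.r_coset_hom_Mod by unfold_locales
  have gen: "generate F2 {?a, ?b} = carrier F2"
    using generate_letters_free_group[of "{0, 1::nat}"] by (simp add: F2_def)
  \<comment> \<open>The letter 1 stays a numeral, so that the facts about \<open>?b\<close> keep matching.\<close>
  note One_nat_def [simp del]
  from gen have ab [simp]: "?a \<in> carrier F2" "?b \<in> carrier F2"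
    using generate.incl[of _ "{?a, ?b}" F2] by auto
  have b_ne: "?b \<noteq> \<one>\<^bsub>F2\<^esub>"
    by (simp add: F2_def free_group_def)

  have "word_value ?H ?g \<in> hom F2 ?H"
    unfolding F2_def by (rule H.word_value_hom) auto
  then interpret v: group_hom F2 ?H "word_value ?H ?g"
    by unfold_locales
  have "{x [^]\<^bsub>F2\<^esub> (3::nat) | x. primitive F2 x} \<subseteq> kernel F2 ?H (word_value ?H ?g)"
    by (auto simp: kernel_def primitive_def subset_iff v.hom_nat_pow
        intro!: heisenberg_group_cube[simplified])
  then have "P3 \<subseteq> kernel F2 ?H (word_value ?H ?g)"
    unfolding P3_def by (rule F2.generate_subgroup_incl[OF _ v.subgroup_kernel])
  then obtain f where f: "f \<in> hom ?Q ?H"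
    and f_coset: "\<And>x. x \<in> carrier F2 \<Longrightarrow> f (P3 #>\<^bsub>F2\<^esub> x) = word_value ?H ?g x"
    using v.FactGroup_universal_kernel[OF normal_P3] by metis

  have cube: "(P3 #>\<^bsub>F2\<^esub> x) [^]\<^bsub>?Q\<^esub> (3::nat) = \<one>\<^bsub>?Q\<^esub>" if "primitive F2 x" for x
  proof -
    have x: "x \<in> carrier F2" using that by (auto simp: primitive_def)
    have "x [^]\<^bsub>F2\<^esub> (3::nat) \<in> P3"
      unfolding P3_def using that by (intro generate.incl) blast
    then have "P3 #>\<^bsub>F2\<^esub> (x [^]\<^bsub>F2\<^esub> (3::nat)) = P3"
      using P3.subgroup_axioms by (intro F2.coset_join2) (auto simp: x)
    then show ?thesis
      using x by (simp add: \<pi>.hom_nat_pow[symmetric])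
  qed
  let ?A = "P3 #>\<^bsub>F2\<^esub> ?a" and ?B = "P3 #>\<^bsub>F2\<^esub> ?b"
  interpret Q: four_cubes ?Q ?A ?B
  proof
    show "?A [^]\<^bsub>?Q\<^esub> (3::nat) = \<one>\<^bsub>?Q\<^esub>" "?B [^]\<^bsub>?Q\<^esub> (3::nat) = \<one>\<^bsub>?Q\<^esub>"
      by (rule cube, rule F2.primitive_basis[OF gen], simp)+
    show "(?A \<otimes>\<^bsub>?Q\<^esub> ?B) [^]\<^bsub>?Q\<^esub> (3::nat) = \<one>\<^bsub>?Q\<^esub>"
      using cube[OF F2.primitive_mult(1)[OF gen b_ne]]
      by (simp only: \<pi>.hom_mult ab)
    show "(?A \<otimes>\<^bsub>?Q\<^esub> inv\<^bsub>?Q\<^esub> ?B) [^]\<^bsub>?Q\<^esub> (3::nat) = \<one>\<^bsub>?Q\<^esub>"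
      using cube[OF F2.primitive_mult(2)[OF gen b_ne]]
      by (simp only: \<pi>.hom_mult \<pi>.hom_inv ab F2.inv_closed)
  qed (rule \<pi>.hom_closed; simp)+
  have "generate ?Q {?A, ?B} = (\<lambda>x. P3 #>\<^bsub>F2\<^esub> x) ` carrier F2"
    using \<pi>.generate_img[of "{?a, ?b}"] gen by simp
  then have "generate ?Q {?A, ?B} = carrier ?Q"
    by (auto simp: FactGroup_def RCOSETS_def)
  then have "f \<in> iso ?Q ?H"
    using f by (rule Q.iso_heisenberg_group)
      (simp_all add: f_coset word_value_Cons heisenberg_mat_mult)
  then show ?thesis by (rule is_isoI)
qed

end
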